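(* Let $D=D_1\times\cdots\times D_n\subset\mathbb{C}^n$ be a bounded product domain, where each $D_j\subset\mathbb{C}$ is a domain with piecewise $C^1$ boundary, and let $p\in[1,\infty]$. There is a constant $C>0$ such that, whenever $f$ is a $(0,1)$-form on $D$ with $\bar\partial f=0$ weakly and $f_I\in L^p(D)$ for all nonempty $I\subset\{1,\dots,n\}$, $$\|T(f)\|_{L^p(D)}\le C\sum_{I\neq\emptyset}\|f_I\|_{L^p(D)},\qquad\text{where } T(f)=-\sum_{\emptyset\neq I\subset\{1,\dots,n\}}\bm{C}^{I}\left(f_{I}^{I^c}\right).$$
   Context: For a $(0,1)$-form $f=\sum_{j=1}^n f_j\,d\bar z_j$ on $D$ and a nonempty $I=\{i_1,\dots,i_l\}\subset\{1,\dots,n\}$, set $f_I=f_j$ if $I=\{j\}$ and $$f_I=\frac{\partial^{l-1}f_{i_1}}{\partial\bar\zeta_{i_2}\cdots\partial\bar\zeta_{i_l}}\quad\text{if } l>1,$$ with derivatives in the sense of distributions. When $\bar\partial f=0$ weakly, $f_I$ depends only on the set $I$, not on the ordering of its elements. $I^c=\{1,\dots,n\}\setminus I$. The superscript $I^c$ in $f_I^{I^c}$ means that the variables $z_j$, $j\in I^c$, are fixed, and $\bm{C}^I$ is the partial solid multi-Cauchy transform: for $I=\{i_1,\dots,i_l\}$, $$\bm{C}^I\left(f_I^{I^c}\right)(z)=\frac{1}{(2\pi i)^l}\int_{D_{i_1}\times\cdots\times D_{i_l}}\frac{f_I(w)\,d\bar\zeta_{i_1}\wedge d\zeta_{i_1}\wedge\cdots\wedge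 d\bar\zeta_{i_l}\wedge d\zeta_{i_l}}{(\zeta_{i_1}-z_{i_1})\cdots(\zeta_{i_l}-z_{i_l})},$$ where $w_i=\zeta_i$ for $i\in I$ and $w_j=z_j$ for $j\in I^c$; it is defined for a.e. $z\in D$. *)

theory Defs
  imports "HOL-Analysis.Analysis" "HOL-Probability.Essential_Supremum"
begin

section \<open>Planar domains with piecewise \<open>C\<^sup>1\<close> boundary\<close>

(* C^1 up to the endpoints (one-sided derivatives there), with nonvanishing velocity. *)
definition regular_C1_on :: "real \<Rightarrow> real \<Rightarrow> (real \<Rightarrow> complex) \<Rightarrow> bool" where
  "regular_C1_on a b g \<longleftrightarrow>
     (\<exists>g'. continuous_on {a..b} g' \<and>
           (\<forall>t\<in>{a..b}. (g has_vector_derivative g' t) (at t within {a..b}) \<and> g' t \<noteq> 0))"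

(* S is the set of breakpoints of a partition of the parameter interval.  The library's
   piecewise_C1_differentiable_on would not do: it lets the derivative vanish, or blow up
   at a breakpoint. *)
definition piecewise_C1_Jordan_curve :: "(real \<Rightarrow> complex) \<Rightarrow> bool" where
  "piecewise_C1_Jordan_curve g \<longleftrightarrow>
     simple_path g \<and> pathfinish g = pathstart g \<and>
     (\<exists>S. finite S \<and> {0, 1} \<subseteq> S \<and> S \<subseteq> {0..1} \<and>
          (\<forall>a\<in>S. \<forall>b\<in>S. a < b \<and> {a<..<b} \<inter> S = {} \<longrightarrow> regular_C1_on a b g))"

(* The boundary consists of finitely many disjoint closed curves.  As the domain is connected
   and misses its boundary, it automatically lies on one side of each of them. *)
definition piecewise_C1_domain :: "complex set \<Rightarrow> bool" where
  "piecewise_C1_domain U \<longleftrightarrow>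
     open U \<and> connected U \<and> U \<noteq> {} \<and>
     (\<exists>\<Gamma>. finite \<Gamma> \<and> (\<forall>g\<in>\<Gamma>. piecewise_C1_Jordan_curve g) \<and>
          disjoint_family_on path_image \<Gamma> \<and> frontier U = (\<Union>g\<in>\<Gamma>. path_image g))"

definition product_domain :: "('n::finite \<Rightarrow> complex set) \<Rightarrow> (complex ^ 'n) set" where
  "product_domain D = {z. \<forall>j. z $ j \<in> D j}"


section \<open>Test functions and distributional derivatives\<close>

definition dir_deriv :: "'a::real_normed_vector \<Rightarrow> ('a \<Rightarrow> complex) \<Rightarrow> 'a \<Rightarrow> complex" where
  "dir_deriv v \<phi> x = frechet_derivative \<phi> (at x) v"

(* All iterated directional derivatives exist and are again Frechet differentiable. *)
definition smooth_function :: "('a::euclidean_space \<Rightarrow> complex) \<Rightarrow> bool" where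
  "smooth_function \<phi> \<longleftrightarrow> (\<forall>vs x. fold dir_deriv vs \<phi> differentiable (at x))"

definition test_function :: "'a::euclidean_space set \<Rightarrow> ('a \<Rightarrow> complex) \<Rightarrow> bool" where
  "test_function \<Omega> \<phi> \<longleftrightarrow>
     smooth_function \<phi> \<and> compact (closure {x. \<phi> x \<noteq> 0}) \<and> closure {x. \<phi> x \<noteq> 0} \<subseteq> \<Omega>"

(* The Wirtinger derivative (d/dx_j + i d/dy_j) / 2 with respect to the conjugate of z_j. *)
definition dbar :: "'n::finite \<Rightarrow> (complex ^ 'n \<Rightarrow> complex) \<Rightarrow> complex ^ 'n \<Rightarrow> complex" where
  "dbar j \<phi> z = (dir_deriv (axis j 1) \<phi> z + \<i> * dir_deriv (axis j \<i>) \<phi> z) / 2"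

definition locally_integrable_on ::
    "(complex ^ 'n \<Rightarrow> complex) \<Rightarrow> (complex ^ 'n::finite) set \<Rightarrow> bool" where
  "locally_integrable_on u \<Omega> \<longleftrightarrow> (\<forall>K. compact K \<and> K \<subseteq> \<Omega> \<longrightarrow> set_integrable lebesgue K u)"

(* g is the distributional derivative of u, one d-bar derivative for each entry of js. *)
definition weak_dbar :: "(complex ^ 'n::finite) set \<Rightarrow> 'n list \<Rightarrow>
    (complex ^ 'n \<Rightarrow> complex) \<Rightarrow> (complex ^ 'n \<Rightarrow> complex) \<Rightarrow> bool" where
  "weak_dbar \<Omega> js u g \<longleftrightarrow>
     locally_integrable_on u \<Omega> \<and> locally_integrable_on g \<Omega> \<and>
     (\<forall>\<phi>. test_function \<Omega> \<phi> \<longrightarrow>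
        (LINT z:\<Omega>|lebesgue. g z * \<phi> z) =
        (- 1) ^ length js * (LINT z:\<Omega>|lebesgue. u z * fold dbar js \<phi> z))"


section \<open>\<open>(0,1)\<close>-forms\<close>

(* A (0,1)-form is given by its coefficients f j.  The equation says that the distributions
   d f_j / d zbar_i and d f_i / d zbar_j agree, i.e. the coefficients of the (0,2)-form
   d-bar f vanish. *)
definition weakly_dbar_closed ::
    "(complex ^ 'n::finite) set \<Rightarrow> ('n \<Rightarrow> complex ^ 'n \<Rightarrow> complex) \<Rightarrow> bool" where
  "weakly_dbar_closed \<Omega> f \<longleftrightarrow>
     (\<forall>j. locally_integrable_on (f j) \<Omega>) \<and>
     (\<forall>i j \<phi>. test_function \<Omega> \<phi> \<longrightarrow>
        (LINT z:\<Omega>|lebesgue. f j z * dbar i \<phi> z) = (LINT z:\<Omega>|lebesgue. f i z * dbar j \<phi> z))"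

(* g is (a representative of) f_I, computed from some enumeration i # js of I; for d-bar closed
   f the choice of the enumeration is immaterial. *)
definition form_coeff :: "(complex ^ 'n::finite) set \<Rightarrow> ('n \<Rightarrow> complex ^ 'n \<Rightarrow> complex) \<Rightarrow>
    'n set \<Rightarrow> (complex ^ 'n \<Rightarrow> complex) \<Rightarrow> bool" where
  "form_coeff \<Omega> f I g \<longleftrightarrow>
     (\<exists>i js. distinct (i # js) \<and> set (i # js) = I \<and>
        (if js = [] then AE z in lebesgue_on \<Omega>. g z = f i z else weak_dbar \<Omega> js (f i) g))"


section \<open>\<open>L\<^sup>p\<close> spaces\<close>

definition Lp_norm :: "ennreal \<Rightarrow> 'a measure \<Rightarrow> ('a \<Rightarrow> complex) \<Rightarrow> ennreal" where
  "Lp_norm p M u =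
     (if p = \<infinity> then esssup M (\<lambda>x. ennreal (cmod (u x)))
      else let J = (\<integral>\<^sup>+ x. ennreal (cmod (u x) powr enn2real p) \<partial>M)
           in if J = \<infinity> then \<infinity> else ennreal (enn2real J powr (1 / enn2real p)))"

definition in_Lp :: "ennreal \<Rightarrow> 'a measure \<Rightarrow> ('a \<Rightarrow> complex) \<Rightarrow> bool" where
  "in_Lp p M u \<longleftrightarrow> u \<in> borel_measurable M \<and> Lp_norm p M u < \<infinity>"


section \<open>Partial solid multi-Cauchy transforms\<close>

definition mix :: "'n::finite set \<Rightarrow> ('n \<Rightarrow> complex) \<Rightarrow> complex ^ 'n \<Rightarrow> complex ^ 'n" where
  "mix I \<zeta> z = (\<chi> j. if j \<in> I then \<zeta> j else z $ j)"

definition solid_cauchy_integrand :: "'n::finite set \<Rightarrow> (complex ^ 'n \<Rightarrow> complex) \<Rightarrow>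
    complex ^ 'n \<Rightarrow> ('n \<Rightarrow> complex) \<Rightarrow> complex" where
  "solid_cauchy_integrand I g z \<zeta> = g (mix I \<zeta> z) / (\<Prod>i\<in>I. \<zeta> i - z $ i)"

(* Lebesgue measure on the space of the variables indexed by I.  It is completed because
   the slices of a Lebesgue measurable function need not be Borel measurable. *)
definition lebesgue_vars :: "'n::finite set \<Rightarrow> ('n \<Rightarrow> complex) measure" where
  "lebesgue_vars I = completion (PiM I (\<lambda>_. lborel))"

(* The factor (2 i)^|I| is due to d zetabar /\ d zeta = 2 i dx /\ dy in each variable. *)
definition solid_cauchy :: "('n::finite \<Rightarrow> complex set) \<Rightarrow> 'n set \<Rightarrow>
    (complex ^ 'n \<Rightarrow> complex) \<Rightarrow> complex ^ 'n \<Rightarrow> complex" where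
  "solid_cauchy D I g z =
     1 / (2 * of_real pi * \<i>) ^ card I *
     ((2 * \<i>) ^ card I * (LINT \<zeta>:Pi\<^sub>E I D|lebesgue_vars I. solid_cauchy_integrand I g z \<zeta>))"

(* F I plays the role of f_I. *)
definition T_op :: "('n::finite \<Rightarrow> complex set) \<Rightarrow> ('n set \<Rightarrow> complex ^ 'n \<Rightarrow> complex) \<Rightarrow>
    complex ^ 'n \<Rightarrow> complex" where
  "T_op D F z = - (\<Sum>I\<in>{I. I \<noteq> {}}. solid_cauchy D I (F I) z)"

end

theory Submission
  imports Defs
begin

text \<open>
  Each summand of \<open>T\<close> is bounded on \<open>L\<^sup>p\<close> separately, by Schur's test. Since \<open>D\<close> is bounded,
  \<open>1 / |\<zeta> - z|\<close> may be replaced by its truncation to \<open>|\<zeta> - z| < 2 r\<close>, whose integral \<open>\<kappa>\<close> over the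
  plane is finite and independent of \<open>z\<close>. The product kernel in the variables \<open>I\<close> then has mass
  \<open>\<kappa> ^ |I|\<close> in \<open>\<zeta>\<close> for fixed \<open>z\<close>, and also in \<open>z\<close> for fixed \<open>\<zeta>\<close>, so Jensen's inequality in \<open>\<zeta>\<close>
  followed by Tonelli's theorem gives the estimate.
\<close>

section \<open>Lebesgue measure in groups of complex variables\<close>

text \<open>The preimages of a set under \<open>f\<close> and \<open>g\<close> differ only inside a
  null set, which the completion absorbs. This yields measurability of slices of functions that are
  merely Lebesgue measurable.\<close>

lemma AE_eq_imp_measurable_completion:
  assumes f: "f \<in> M \<rightarrow>\<^sub>M N" and ae: "AE x in M. f x = g x"
    and g: "g \<in> space M \<rightarrow> space N"
  shows "g \<in> completion M \<rightarrow>\<^sub>M N"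
proof (rule measurableI)
  fix A assume A: "A \<in> sets N"
  have "AE x in completion M. x \<in> f -` A \<inter> space M \<longleftrightarrow> x \<in> g -` A \<inter> space M"
    using AE_completion[OF ae] by eventually_elim auto
  moreover have "f -` A \<inter> space M \<in> sets (completion M)"
    using measurable_sets[OF f A] by auto
  ultimately have "g -` A \<inter> space M \<in> sets (completion M)"
    by (rule completion.in_sets_AE) auto
  then show "g -` A \<inter> space (completion M) \<in> sets (completion M)" by simp
qed (use g in auto)

lemma borel_measurable_vec_nth [measurable]:
  "(\<lambda>x::('a::euclidean_space)^'n::finite. x $ i) \<in> borel_measurable borel"
  by (intro borel_measurable_continuous_onI continuous_intros)

lemma borel_measurable_vec_lambda [measurable (raw)]:
  fixes f :: "'m \<Rightarrow> 'n::finite \<Rightarrow> 'a::euclidean_space"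
  assumes [measurable]: "\<And>i. (\<lambda>x. f x i) \<in> borel_measurable M"
  shows "(\<lambda>x. \<chi> i. f x i) \<in> borel_measurable M"
  by (subst borel_measurable_euclidean_space) (auto simp: Basis_vec_def inner_axis)

lemma prod_Basis_vec:
  fixes g :: "('a::euclidean_space)^'n::finite \<Rightarrow> 'b::comm_monoid_mult"
  shows "(\<Prod>b\<in>Basis. g b) = (\<Prod>i\<in>UNIV. \<Prod>b\<in>Basis. g (axis i b))"
proof -
  have B: "(Basis :: ('a^'n) set) = (\<lambda>(i, b). axis i b) ` (UNIV \<times> Basis)"
    by (auto simp: Basis_vec_def)
  have "inj_on (\<lambda>(i, b). axis i b :: 'a^'n) (UNIV \<times> Basis)"
    by (auto simp: inj_on_def axis_eq_axis)
  then show ?thesis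
    by (simp add: B prod.reindex prod.cartesian_product case_prod_unfold)
qed

text \<open>Lebesgue measure is determined by its values on boxes, and a box of vectors is a product
  of boxes in the factors. The identification makes Tonelli's theorem for \<open>PiM\<close>
  available.\<close>

lemma lborel_vec_eq_distr:
  "(lborel :: (('a::euclidean_space)^'n::finite) measure) =
     distr (PiM UNIV (\<lambda>_. lborel)) borel (\<lambda>x. \<chi> i. x i)"
proof (rule lborel_eqI)
  interpret product_sigma_finite "\<lambda>_::'n. lborel :: 'a measure" by standard
  fix l u :: "'a^'n"
  assume le: "\<And>b. b \<in> Basis \<Longrightarrow> l \<bullet> b \<le> u \<bullet> b"
  have le': "l $ i \<bullet> b \<le> u $ i \<bullet> b" if "b \<in> Basis" for i b
    using le[of "axis i b"] that by (auto simp: inner_axis)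
  have "(\<lambda>x. \<chi> i. x i) -` box l u \<inter> space (PiM UNIV (\<lambda>_. lborel)) =
      (\<Pi>\<^sub>E i\<in>UNIV. box (l $ i) (u $ i))"
    by (auto simp: space_PiM mem_box Basis_vec_def inner_axis PiE_iff)
  then have "emeasure (distr (PiM UNIV (\<lambda>_. lborel)) borel (\<lambda>x. \<chi> i. x i)) (box l u) =
      (\<Prod>i\<in>UNIV. emeasure lborel (box (l $ i) (u $ i)))"
    by (simp add: emeasure_distr emeasure_PiM)
  also have "\<dots> = (\<Prod>i\<in>UNIV. ennreal (\<Prod>b\<in>Basis. (u $ i - l $ i) \<bullet> b))"
    using le' by (intro prod.cong refl) (simp add: emeasure_lborel_box)
  also have "\<dots> = ennreal (\<Prod>i\<in>UNIV. \<Prod>b\<in>Basis. (u $ i - l $ i) \<bullet> b)"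
    using le' by (intro prod_ennreal prod_nonneg) (auto simp: inner_diff_left)
  finally show "emeasure (distr (PiM UNIV (\<lambda>_. lborel)) borel (\<lambda>x. \<chi> i. x i)) (box l u) =
      (\<Prod>b\<in>Basis. (u - l) \<bullet> b)"
    by (simp add: prod_Basis_vec inner_axis)
qed simp

section \<open>Tonelli's theorem for a group of variables\<close>

lemma measurable_mix [measurable (raw)]:
  assumes [measurable]: "f \<in> M \<rightarrow>\<^sub>M PiM I (\<lambda>_. lborel)" "g \<in> M \<rightarrow>\<^sub>M borel"
  shows "(\<lambda>x. mix I (f x) (g x)) \<in> M \<rightarrow>\<^sub>M borel"
  unfolding mix_def
proof (rule borel_measurable_vec_lambda)
  fix i
  show "(\<lambda>x. if i \<in> I then f x i else g x $ i) \<in> borel_measurable M"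
  proof (cases "i \<in> I")
    case True
    then have "(\<lambda>x. f x i) \<in> M \<rightarrow>\<^sub>M lborel" by measurable
    with True show ?thesis by simp
  qed simp
qed

lemma nn_integral_lborel_vec_split:
  fixes h :: "complex^'n::finite \<Rightarrow> ennreal"
  assumes [measurable]: "h \<in> borel_measurable borel"
  shows "(\<integral>\<^sup>+z. h z \<partial>lborel) =
    (\<integral>\<^sup>+y. \<integral>\<^sup>+x. h (mix I x (\<chi> j. y j)) \<partial>PiM I (\<lambda>_. lborel) \<partial>PiM (- I) (\<lambda>_. lborel))"
proof -
  interpret product_sigma_finite "\<lambda>_::'n. lborel :: complex measure" by standard
  have merge: "(\<chi> i. merge (-I) I (y, x) i) = mix I x (\<chi> j. y j)" for x y
    by (auto simp: mix_def vec_eq_iff merge_def)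
  have "(\<integral>\<^sup>+z. h z \<partial>lborel) = (\<integral>\<^sup>+x. h (\<chi> i. x i) \<partial>PiM (- I \<union> I) (\<lambda>_. lborel))"
    by (simp add: lborel_vec_eq_distr nn_integral_distr)
  also have "\<dots> = (\<integral>\<^sup>+y. \<integral>\<^sup>+x. h (\<chi> i. merge (-I) I (y, x) i)
      \<partial>PiM I (\<lambda>_. lborel) \<partial>PiM (- I) (\<lambda>_. lborel))"
    by (rule product_nn_integral_fold) auto
  finally show ?thesis by (simp add: merge)
qed

text \<open>The map \<open>(z, \<zeta>) \<mapsto> (mix I \<zeta> z, z|\<^sub>I)\<close> preserves the product measure.\<close>

lemma nn_integral_mix_swap:
  fixes G :: "complex^'n::finite \<Rightarrow> ('n \<Rightarrow> complex) \<Rightarrow> ennreal"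
  assumes G: "case_prod G \<in> borel_measurable (borel \<Otimes>\<^sub>M PiM I (\<lambda>_. lborel))"
  shows "(\<integral>\<^sup>+z. \<integral>\<^sup>+\<zeta>. G (mix I \<zeta> z) (\<lambda>i\<in>I. z $ i) \<partial>PiM I (\<lambda>_. lborel) \<partial>lborel) =
    (\<integral>\<^sup>+z. \<integral>\<^sup>+\<zeta>. G z \<zeta> \<partial>PiM I (\<lambda>_. lborel) \<partial>lborel)"
proof -
  interpret product_sigma_finite "\<lambda>_::'n. lborel :: complex measure" by standard
  let ?P = "PiM I (\<lambda>_. lborel :: complex measure)"
  interpret P: sigma_finite_measure ?P by (rule sigma_finite) simp
  interpret PP: pair_sigma_finite ?P ?P by standard
  note [measurable (raw)] = measurable_compose[OF measurable_Pair G, unfolded split_conv]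
  \<comment> \<open>Points of the product space are extensional, so the restriction returns
    \<open>x\<close> itself and not just a function agreeing with \<open>x\<close> on
    \<open>I\<close>.\<close>
  have restr: "(\<lambda>i\<in>I. mix I x v $ i) = x" if "x \<in> space ?P" for x v
    using that by (auto simp: mix_def space_PiM fun_eq_iff PiE_def extensional_def)
  have mm: "mix I \<zeta> (mix I x v) = mix I \<zeta> v" for \<zeta> x and v :: "complex^'n"
    by (simp add: mix_def vec_eq_iff)
  have [measurable]: "(\<lambda>z. \<integral>\<^sup>+\<zeta>. G (mix I \<zeta> z) (\<lambda>i\<in>I. z $ i) \<partial>?P) \<in> borel_measurable borel"
     "(\<lambda>z. \<integral>\<^sup>+\<zeta>. G z \<zeta> \<partial>?P) \<in> borel_measurable borel"
    by measurable
  have "(\<integral>\<^sup>+z. \<integral>\<^sup>+\<zeta>. G (mix I \<zeta> z) (\<lambda>i\<in>I. z $ i) \<partial>?P \<partial>lborel) =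
     (\<integral>\<^sup>+y. \<integral>\<^sup>+x. \<integral>\<^sup>+\<zeta>. G (mix I \<zeta> (\<chi> j. y j)) x \<partial>?P \<partial>?P \<partial>PiM (- I) (\<lambda>_. lborel))"
    by (subst nn_integral_lborel_vec_split[where I=I])
       (auto simp: mm restr intro!: nn_integral_cong)
  \<comment> \<open>With z split into its coordinates x in \<open>I\<close> and y in
    \<open>- I\<close>, the map only exchanges x and \<zeta>, so the claim is the interchange of the
    two inner integrals.\<close>
  also have "\<dots> = (\<integral>\<^sup>+y. \<integral>\<^sup>+\<zeta>. \<integral>\<^sup>+x. G (mix I \<zeta> (\<chi> j. y j)) x \<partial>?P \<partial>?P \<partial>PiM (- I) (\<lambda>_. lborel))"
    by (intro nn_integral_cong PP.Fubini') (simp add: case_prod_unfold)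
  also have "\<dots> = (\<integral>\<^sup>+z. \<integral>\<^sup>+\<zeta>. G z \<zeta> \<partial>?P \<partial>lborel)"
    by (subst nn_integral_lborel_vec_split[where I=I]) auto
  finally show ?thesis .
qed

text \<open>Apply the swap identity to the indicator of a null set, with \<open>G\<close>
  independent of its second argument: almost every slice of the null set is null.\<close>

lemma AE_mix:
  fixes Q :: "complex^'n::finite \<Rightarrow> bool"
  assumes "AE w in lborel. Q w"
  shows "AE z in lborel. AE \<zeta> in PiM I (\<lambda>_. lborel). Q (mix I \<zeta> z)"
proof -
  interpret product_sigma_finite "\<lambda>_::'n. lborel :: complex measure" by standard
  let ?P = "PiM I (\<lambda>_. lborel :: complex measure)"
  interpret P: sigma_finite_measure ?P by (rule sigma_finite) simp
  obtain N where N [measurable]: "N \<in> sets borel" and N0: "emeasure lborel N = 0"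
    and sub: "{w. \<not> Q w} \<subseteq> N"
    using AE_E[OF assms] by (auto)
  have "(\<integral>\<^sup>+z. \<integral>\<^sup>+\<zeta>. indicator N (mix I \<zeta> z) \<partial>?P \<partial>lborel) =
      (\<integral>\<^sup>+z. \<integral>\<^sup>+\<zeta>. indicator N z \<partial>?P \<partial>lborel)"
    using nn_integral_mix_swap[of "\<lambda>w _. indicator N w" I] by simp
  \<comment> \<open>The inner integrand is constant in \<zeta>, and for nonempty \<open>I\<close>
    the \<zeta>-space has infinite mass; multiplied by the measure 0 of \<open>N\<close> this still
    gives 0 in \<open>ennreal\<close>.\<close>
  also have "\<dots> = 0"
    using N0 by (simp add: nn_integral_multc)
  finally have "AE z in lborel. (\<integral>\<^sup>+\<zeta>. indicator N (mix I \<zeta> z) \<partial>?P) = 0"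
    by (subst (asm) nn_integral_0_iff_AE) auto
  then show ?thesis
  proof eventually_elim
    case (elim z)
    then have "AE \<zeta> in ?P. indicator N (mix I \<zeta> z) = (0::ennreal)"
      by (subst (asm) nn_integral_0_iff_AE) auto
    then show ?case
      by (rule AE_mp) (use sub in \<open>auto simp: indicator_eq_0_iff\<close>)
  qed
qed


section \<open>Averages against the truncated Cauchy kernel\<close>

text \<open>Since 1 / 0 = 0, the kernel vanishes at the origin. This matches the value 0 of
  \<open>solid_cauchy_integrand\<close> wherever its denominator is zero.\<close>

definition cauchy_kernel :: "real \<Rightarrow> complex \<Rightarrow> ennreal" where
  "cauchy_kernel R \<zeta> = ennreal (1 / cmod \<zeta>) * indicator (ball 0 R) \<zeta>"

lemma borel_measurable_cauchy_kernel [measurable]: "cauchy_kernel R \<in> borel_measurable borel"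
proof -
  have [measurable]: "ball (0::complex) R \<in> sets borel" by simp
  show ?thesis unfolding cauchy_kernel_def[abs_def] by measurable
qed

lemma cauchy_kernel_minus_commute: "cauchy_kernel R (x - y) = cauchy_kernel R (y - x)"
  by (simp add: cauchy_kernel_def indicator_def norm_minus_commute)

text \<open>Dyadic annuli: on \<open>R / 2 ^ (k + 1) \<le> |\<zeta>| < R / 2 ^ k\<close> the kernel is at most \<open>2 ^ (k + 1) / R\<close>,
  while the area of the annulus is \<open>O(4 ^ - k)\<close>.\<close>

lemma cauchy_kernel_le_suminf:
  "cauchy_kernel R \<zeta> \<le> (\<Sum>k. ennreal (2 ^ Suc k / R) * indicator (ball 0 (R / 2 ^ k)) \<zeta>)"
    (is "_ \<le> (\<Sum>k. ?t k)")
proof (cases "0 < cmod \<zeta> \<and> cmod \<zeta> < R")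
  case True
  then have R: "0 < R" and z: "0 < cmod \<zeta>" by linarith+
  have le_suminf: "f k \<le> suminf f" for f :: "nat \<Rightarrow> ennreal" and k
    using sum_le_suminf[of f "{k}"] by simp
  obtain n where n: "R / cmod \<zeta> \<le> 2 ^ n"
    using real_arch_pow[of 2 "R / cmod \<zeta>"] by (auto intro: less_imp_le)
  \<comment> \<open>By minimality, k = m - 1 is the index of the dyadic annulus containing \<zeta>;
    m is not 0 because |\<zeta>| < R.\<close>
  define m where "m = (LEAST n. R / cmod \<zeta> \<le> 2 ^ n)"
  have m: "R / cmod \<zeta> \<le> 2 ^ m" unfolding m_def by (rule LeastI) (rule n)
  have "m \<noteq> 0"
  proof
    assume "m = 0"
    with m True show False by (simp add: field_simps)
  qed
  then obtain k where k: "m = Suc k" by (cases m) auto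
  have "\<not> R / cmod \<zeta> \<le> 2 ^ k"
    using not_less_Least[of k "\<lambda>n. R / cmod \<zeta> \<le> 2 ^ n"] k unfolding m_def by simp
  then have "cmod \<zeta> < R / 2 ^ k" using z by (simp add: field_simps)
  moreover have "1 / cmod \<zeta> \<le> 2 ^ Suc k / R"
    using m R z unfolding k by (simp add: field_simps)
  ultimately have "cauchy_kernel R \<zeta> \<le> ?t k"
    using True by (simp add: cauchy_kernel_def ennreal_leI)
  also have "\<dots> \<le> (\<Sum>k. ?t k)"
    by (rule le_suminf)
  finally show ?thesis .
qed (auto simp: cauchy_kernel_def indicator_def)

lemma nn_integral_cauchy_kernel_finite:
  assumes R: "0 < R"
  shows "(\<integral>\<^sup>+\<zeta>. cauchy_kernel R \<zeta> \<partial>lborel) < \<infinity>"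
proof -
  \<comment> \<open>The k-th term integrates to \<open>2 ^ Suc k / R\<close> times the area of the
    disc of radius \<open>R / 2 ^ k\<close>, that is \<open>?c\<close> times
    \<open>(1 / 2) ^ k\<close>: a geometric series.\<close>
  let ?c = "unit_ball_vol (real DIM(complex)) * 2 * R"
  have [measurable]: "ball (0::complex) r \<in> sets borel" for r by simp
  have "(\<integral>\<^sup>+\<zeta>. cauchy_kernel R \<zeta> \<partial>lborel) \<le>
      (\<integral>\<^sup>+\<zeta>. (\<Sum>k. ennreal (2 ^ Suc k / R) * indicator (ball 0 (R / 2 ^ k)) \<zeta>) \<partial>(lborel :: complex measure))"
    by (intro nn_integral_mono cauchy_kernel_le_suminf)
  also have "\<dots> = (\<Sum>k. ennreal (2 ^ Suc k / R) * emeasure lborel (ball (0::complex) (R / 2 ^ k)))"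
    by (subst nn_integral_suminf) (simp_all add: nn_integral_cmult_indicator)
  also have "\<dots> = (\<Sum>k. ennreal (?c * (1 / 2) ^ k))"
  proof (intro suminf_cong)
    fix k
    have "2 ^ Suc k / R * (unit_ball_vol 2 * (R / 2 ^ k) ^ 2) = unit_ball_vol 2 * 2 * R * (1 / 2) ^ k"
      using R by (simp add: power2_eq_square power_divide field_simps)
    then show "ennreal (2 ^ Suc k / R) * emeasure lborel (ball (0::complex) (R / 2 ^ k)) =
        ennreal (?c * (1 / 2) ^ k)"
      using R by (simp add: emeasure_ball flip: ennreal_mult)
  qed
  also have "\<dots> = ennreal (\<Sum>k. ?c * (1 / 2) ^ k)"
    using R by (intro suminf_ennreal2) (auto intro!: summable_mult summable_geometric)
  finally show ?thesis
    by (rule le_less_trans) simp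
qed

lemma nn_integral_cauchy_kernel_shift:
  "(\<integral>\<^sup>+\<zeta>. cauchy_kernel R (\<zeta> - z) \<partial>lborel) = (\<integral>\<^sup>+\<zeta>. cauchy_kernel R \<zeta> \<partial>lborel)"
proof -
  have "(\<integral>\<^sup>+\<zeta>. cauchy_kernel R \<zeta> \<partial>lborel) =
      (\<integral>\<^sup>+\<zeta>. cauchy_kernel R \<zeta> \<partial>distr lborel borel ((+) (- z)))"
    by (simp add: lborel_distr_plus)
  also have "\<dots> = (\<integral>\<^sup>+\<zeta>. cauchy_kernel R (\<zeta> - z) \<partial>lborel)"
    by (subst nn_integral_distr) auto
  finally show ?thesis ..
qed

text \<open>The weight is not normalised; its mass is the \<open>card I\<close>-th power of the mass
  of \<open>cauchy_kernel R\<close>. Values in \<open>ennreal\<close> allow Tonelli's theorem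
  without integrability conditions.\<close>

definition cauchy_average ::
    "real \<Rightarrow> 'n::finite set \<Rightarrow> (complex^'n \<Rightarrow> ennreal) \<Rightarrow> complex^'n \<Rightarrow> ennreal" where
  "cauchy_average R I h z =
     (\<integral>\<^sup>+\<zeta>. h (mix I \<zeta> z) * (\<Prod>i\<in>I. cauchy_kernel R (\<zeta> i - z $ i)) \<partial>PiM I (\<lambda>_. lborel))"

lemma sigma_finite_PiM_lborel:
  "sigma_finite_measure (PiM I (\<lambda>_::'n::finite. lborel :: complex measure))"
proof -
  interpret product_sigma_finite "\<lambda>_::'n. lborel :: complex measure" by standard
  show ?thesis by (rule sigma_finite) simp
qed

lemma measurable_PiM_lborel_component:
  assumes "f \<in> M \<rightarrow>\<^sub>M PiM I (\<lambda>_. lborel)" "i \<in> I"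
  shows "(\<lambda>x. f x i) \<in> borel_measurable M"
  using measurable_compose[OF assms(1) measurable_component_singleton[OF assms(2)]] by simp

lemma borel_measurable_cauchy_average [measurable (raw)]:
  assumes [measurable]: "h \<in> borel_measurable borel"
  shows "cauchy_average R I h \<in> borel_measurable borel"
proof -
  interpret sigma_finite_measure "PiM I (\<lambda>_::'a. lborel :: complex measure)"
    by (rule sigma_finite_PiM_lborel)
  note [measurable (raw)] = measurable_PiM_lborel_component
  show ?thesis unfolding cauchy_average_def by measurable
qed

text \<open>First half of Schur's test, the mass in \<zeta> for fixed z: the integral factorises,
  and each factor is translation invariant.\<close>

lemma nn_integral_prod_cauchy_kernel:
  "(\<integral>\<^sup>+\<zeta>. (\<Prod>i\<in>I. cauchy_kernel R (\<zeta> i - z $ i)) \<partial>PiM I (\<lambda>_::'n::finite. lborel)) =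
    (\<integral>\<^sup>+\<zeta>. cauchy_kernel R \<zeta> \<partial>lborel) ^ card I"
proof -
  interpret product_sigma_finite "\<lambda>_::'n. lborel :: complex measure" by standard
  show ?thesis
    by (subst product_nn_integral_prod) (auto simp: nn_integral_cauchy_kernel_shift)
qed

text \<open>Second half of Schur's test: after the swap, \<open>h\<close> no longer depends on the
  inner variables, and by symmetry of the kernel the remaining weight has the same mass as
  before.\<close>

lemma nn_integral_cauchy_average:
  fixes h :: "complex^'n::finite \<Rightarrow> ennreal"
  assumes [measurable]: "h \<in> borel_measurable borel"
  shows "(\<integral>\<^sup>+z. cauchy_average R I h z \<partial>lborel) =
    (\<integral>\<^sup>+\<zeta>. cauchy_kernel R \<zeta> \<partial>lborel) ^ card I * (\<integral>\<^sup>+z. h z \<partial>lborel)"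
proof -
  let ?P = "PiM I (\<lambda>_. lborel :: complex measure)"
  \<comment> \<open>Chosen so that inserting \<open>mix I \<zeta> z\<close> and the old coordinates
    of z gives back the integrand of \<open>cauchy_average\<close>.\<close>
  define G where "G w \<eta> = h w * (\<Prod>i\<in>I. cauchy_kernel R (w $ i - \<eta> i))" for w and \<eta> :: "'n \<Rightarrow> complex"
  note [measurable (raw)] = measurable_PiM_lborel_component
  have [measurable]: "case_prod G \<in> borel_measurable (borel \<Otimes>\<^sub>M ?P)"
    unfolding G_def by measurable
  have "cauchy_average R I h z = (\<integral>\<^sup>+\<zeta>. G (mix I \<zeta> z) (\<lambda>i\<in>I. z $ i) \<partial>?P)" for z
    unfolding cauchy_average_def G_def
    by (intro nn_integral_cong arg_cong2[where f="(*)"] prod.cong) (auto simp: mix_def)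
  then have "(\<integral>\<^sup>+z. cauchy_average R I h z \<partial>lborel) = (\<integral>\<^sup>+z. \<integral>\<^sup>+\<zeta>. G z \<zeta> \<partial>?P \<partial>lborel)"
    using nn_integral_mix_swap[of G I] by simp
  also have "\<dots> = (\<integral>\<^sup>+z. h z * (\<integral>\<^sup>+\<zeta>. cauchy_kernel R \<zeta> \<partial>lborel) ^ card I \<partial>lborel)"
    unfolding G_def
    by (intro nn_integral_cong)
       (simp add: nn_integral_cmult nn_integral_prod_cauchy_kernel
          cauchy_kernel_minus_commute[of R "_ $ _"])
  finally show ?thesis
    by (simp add: nn_integral_multc mult.commute)
qed

text \<open>Integrate the pointwise bound g \<le> t + t^(1-p) g^p. Where g > t it follows from g =
  g^(1-p) g^p, because the exponent 1 - p is not positive. The level t stays free.\<close>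

lemma nn_integral_weighted_le:
  assumes [measurable]: "g \<in> borel_measurable M" "k \<in> borel_measurable M"
    and g: "\<And>x. 0 \<le> g x" and p: "1 \<le> p" and t: "0 < t"
  shows "(\<integral>\<^sup>+x. ennreal (g x) * k x \<partial>M) \<le>
    ennreal t * (\<integral>\<^sup>+x. k x \<partial>M) + ennreal (t powr (1 - p)) * (\<integral>\<^sup>+x. ennreal (g x powr p) * k x \<partial>M)"
proof -
  have "g x \<le> t + t powr (1 - p) * g x powr p" for x
  proof (cases "g x \<le> t")
    case True
    then show ?thesis by (simp add: add_increasing2)
  next
    case False
    then have gx: "t < g x" by simp
    have "g x = g x powr (1 - p) * g x powr p"
      using gx t by (simp flip: powr_add)
    also have "\<dots> \<le> t powr (1 - p) * g x powr p"
      using gx t p by (intro mult_right_mono powr_mono2') auto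
    finally show ?thesis using t by simp
  qed
  then have "ennreal (g x) \<le> ennreal t + ennreal (t powr (1 - p)) * ennreal (g x powr p)" for x
    using t by (simp add: ennreal_leI flip: ennreal_plus ennreal_mult)
  then have "(\<integral>\<^sup>+x. ennreal (g x) * k x \<partial>M) \<le>
     (\<integral>\<^sup>+x. (ennreal t + ennreal (t powr (1 - p)) * ennreal (g x powr p)) * k x \<partial>M)"
    by (intro nn_integral_mono mult_right_mono) auto
  also have "\<dots> = ennreal t * (\<integral>\<^sup>+x. k x \<partial>M) +
      ennreal (t powr (1 - p)) * (\<integral>\<^sup>+x. ennreal (g x powr p) * k x \<partial>M)"
    by (simp add: distrib_right nn_integral_add nn_integral_cmult mult.assoc)
  finally show ?thesis .
qed

text \<open>Jensen's inequality for the weight \<open>k\<close>, up to the constant \<open>2 powr p\<close>: optimise \<open>t\<close> in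
  the previous lemma.\<close>

lemma powr_le_nn_integral_weighted:
  assumes [measurable]: "g \<in> borel_measurable M" "k \<in> borel_measurable M"
    and g: "\<And>x. 0 \<le> g x" and p: "1 \<le> p"
    and K: "(\<integral>\<^sup>+x. k x \<partial>M) \<le> ennreal K" "0 < K"
    and a: "0 \<le> a" "ennreal a \<le> (\<integral>\<^sup>+x. ennreal (g x) * k x \<partial>M)"
  shows "ennreal (a powr p) \<le>
    ennreal (2 powr p * K powr (p - 1)) * (\<integral>\<^sup>+x. ennreal (g x powr p) * k x \<partial>M)"
proof (cases "(\<integral>\<^sup>+x. ennreal (g x powr p) * k x \<partial>M)")
  case top
  with K show ?thesis by (simp add: ennreal_mult_top)
next
  case (real b)
  have *: "a \<le> t * K + t powr (1 - p) * b" if t: "0 < t" for t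
  proof -
    have "ennreal a \<le> ennreal t * ennreal K + ennreal (t powr (1 - p)) * ennreal b"
      using nn_integral_weighted_le[of g M k, OF _ _ g p t] a(2) real
        add_right_mono[OF mult_left_mono[OF K(1), of "ennreal t"]]
      by (auto intro: order_trans)
    also have "\<dots> = ennreal (t * K + t powr (1 - p) * b)"
      using t K real by (simp add: ennreal_mult)
    finally show ?thesis
      using t K real by (subst (asm) ennreal_le_iff) auto
  qed
  show ?thesis
  proof (cases "b = 0")
    case True
    \<comment> \<open>Only the term t K is left, and it tends to 0 with t.\<close>
    have "a \<le> 0"
    proof (rule field_le_epsilon)
      fix e :: real assume "0 < e"
      then show "a \<le> 0 + e" using *[of "e / K"] True K by simp
    qed
    with a show ?thesis by simp
  next
    case False
    with real have b: "0 < b" by simp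
    \<comment> \<open>This level balances the two terms: t K = t^(1-p) b exactly when t^p = b / K.
      Their sum 2 t K is the source of the factor \<open>2 powr p\<close>.\<close>
    define t where "t = (b / K) powr (1 / p)"
    have t: "0 < t" using b K by (simp add: t_def)
    have tp: "t powr p = b / K" using b K p by (simp add: t_def powr_powr)
    have "t powr (1 - p) * b = t * K"
      using t tp K b p by (simp add: powr_diff field_simps)
    with *[OF t] have "a \<le> 2 * t * K" by (simp add: mult_ac)
    then have "a powr p \<le> (2 * t * K) powr p"
      using a p by (intro powr_mono2) auto
    also have "\<dots> = 2 powr p * K powr (p - 1) * b"
      using t K tp by (simp add: powr_mult powr_diff)
    finally show ?thesis
      using real K by (simp add: ennreal_leI flip: ennreal_mult)
  qed
qed


section \<open>Partial Cauchy transforms\<close>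

lemma open_product_domain:
  fixes D :: "'n::finite \<Rightarrow> complex set"
  assumes "\<And>j. open (D j)"
  shows "open (product_domain D)"
proof -
  have "product_domain D = (\<Inter>j. (\<lambda>z. z $ j) -` D j)"
    by (auto simp: product_domain_def)
  then show ?thesis
    using assms by (auto intro!: open_INT open_vimage_vec_nth)
qed

lemma bounded_component_if_bounded_product_domain:
  fixes D :: "'n::finite \<Rightarrow> complex set"
  assumes "\<And>j. D j \<noteq> {}" and "bounded (product_domain D)"
  obtains r where "0 < r" "\<And>j. D j \<subseteq> ball 0 r"
proof -
  obtain r where r: "0 < r" "\<And>z. z \<in> product_domain D \<Longrightarrow> norm z < r"
    using assms(2) by (auto simp: bounded_pos_less)
  define d where "d j = (SOME w. w \<in> D j)" for j
  have d: "d j \<in> D j" for j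
    using assms(1)[of j] by (simp add: d_def some_in_eq)
  have "cmod w < r" if w: "w \<in> D j" for j w
  proof -
    \<comment> \<open>Nonemptiness of the other factors completes w to a point of the product, whose
      norm dominates |w|.\<close>
    define z where "z = (\<chi> i. if i = j then w else d i)"
    have "norm z < r" using d w by (intro r(2)) (auto simp: product_domain_def z_def)
    then show ?thesis
      using Finite_Cartesian_Product.norm_nth_le[of z j] by (simp add: z_def)
  qed
  then have "D j \<subseteq> ball 0 r" for j by auto
  with r(1) show ?thesis by (rule that)
qed

text \<open>Extend \<open>F\<close> by zero and replace the real and imaginary parts by Borel
  functions equal to them almost everywhere. Tonelli's theorem and the measurability of parameter
  integrals are then applied to \<open>u\<close>.\<close>

lemma lebesgue_on_borel_representative:
  fixes F :: "'a::euclidean_space \<Rightarrow> complex"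
  assumes S [measurable]: "S \<in> sets borel" and F: "F \<in> borel_measurable (lebesgue_on S)"
  obtains u where "u \<in> borel_measurable borel" "\<And>w. w \<notin> S \<Longrightarrow> u w = 0"
    "AE w in lborel. w \<in> S \<longrightarrow> F w = u w"
proof -
  have G: "(\<lambda>w. indicator S w *\<^sub>R F w) \<in> borel_measurable lebesgue"
    using F S by (subst (asm) borel_measurable_restrict_space_iff) auto
  obtain a where a [measurable]: "a \<in> borel_measurable lborel"
    and aF: "AE w in lborel. Re (indicator S w *\<^sub>R F w) = a w"
    using completion_ex_borel_measurable_real[of "\<lambda>w. Re (indicator S w *\<^sub>R F w)" lborel]
      measurable_compose[OF G borel_measurable_Re] by auto
  obtain b where b [measurable]: "b \<in> borel_measurable lborel"
    and bF: "AE w in lborel. Im (indicator S w *\<^sub>R F w) = b w"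
    using completion_ex_borel_measurable_real[of "\<lambda>w. Im (indicator S w *\<^sub>R F w)" lborel]
      measurable_compose[OF G borel_measurable_Im] by auto
  show ?thesis
  proof (rule that)
    \<comment> \<open>The indicator is applied again because \<open>a\<close> and \<open>b\<close>
      vanish off \<open>S\<close> only almost everywhere.\<close>
    show "(\<lambda>w. indicator S w *\<^sub>R (of_real (a w) + \<i> * of_real (b w))) \<in> borel_measurable borel"
      using a b by measurable
    show "AE w in lborel. w \<in> S \<longrightarrow>
        F w = indicator S w *\<^sub>R (of_real (a w) + \<i> * of_real (b w))"
      using aF bF by eventually_elim (auto simp: complex_eq_iff)
  qed auto
qed

section \<open>Integrals of slices of the Cauchy integrand\<close>

lemma mix_in_product_domain:
  "z \<in> product_domain D \<Longrightarrow> \<zeta> \<in> Pi\<^sub>E I D \<Longrightarrow> mix I \<zeta> z \<in> product_domain D"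
  by (auto simp: product_domain_def mix_def)

lemma borel_measurable_solid_cauchy_integrand [measurable (raw)]:
  assumes "u \<in> borel_measurable borel"
    and [measurable]: "f \<in> M \<rightarrow>\<^sub>M borel" "g \<in> M \<rightarrow>\<^sub>M PiM I (\<lambda>_. lborel)"
  shows "(\<lambda>x. solid_cauchy_integrand I u (f x) (g x)) \<in> borel_measurable M"
proof -
  note [measurable] = measurable_compose[OF _ assms(1)]
  note [measurable (raw)] = measurable_PiM_lborel_component
  show ?thesis unfolding solid_cauchy_integrand_def by measurable
qed

lemma sets_PiE_open:
  assumes "\<And>j. open (D j)"
  shows "Pi\<^sub>E I D \<in> sets (PiM I (\<lambda>_::'n::finite. lborel :: complex measure))"
  using assms by (intro sets_PiM_I_finite) auto

lemma borel_measurable_solid_cauchy_integral: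
  fixes D :: "'n::finite \<Rightarrow> complex set"
  assumes "\<And>j. open (D j)" and [measurable]: "u \<in> borel_measurable borel"
  shows "(\<lambda>z. LINT \<zeta>:Pi\<^sub>E I D|PiM I (\<lambda>_. lborel). solid_cauchy_integrand I u z \<zeta>)
    \<in> borel_measurable borel"
proof -
  interpret sigma_finite_measure "PiM I (\<lambda>_::'n. lborel :: complex measure)"
    by (rule sigma_finite_PiM_lborel)
  note [measurable] = sets_PiE_open[OF assms(1), where I=I]
  show ?thesis unfolding set_lebesgue_integral_def by measurable
qed

text \<open>For a point z whose slices of \<open>F\<close> and \<open>u\<close> agree almost
  everywhere, the slice of \<open>F\<close> is measurable for the completion, and completing the
  measure does not affect the integral of the Borel slice.\<close>

lemma solid_cauchy_cong_AE:
  fixes D :: "'n::finite \<Rightarrow> complex set"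
  assumes "\<And>j. open (D j)" and [measurable]: "u \<in> borel_measurable borel"
    and ae: "AE \<zeta> in PiM I (\<lambda>_. lborel). \<zeta> \<in> Pi\<^sub>E I D \<longrightarrow> F (mix I \<zeta> z) = u (mix I \<zeta> z)"
  shows "set_integrable (lebesgue_vars I) (Pi\<^sub>E I D) (solid_cauchy_integrand I F z) \<longleftrightarrow>
      set_integrable (PiM I (\<lambda>_. lborel)) (Pi\<^sub>E I D) (solid_cauchy_integrand I u z)"
    and "(LINT \<zeta>:Pi\<^sub>E I D|lebesgue_vars I. solid_cauchy_integrand I F z \<zeta>) =
      (LINT \<zeta>:Pi\<^sub>E I D|PiM I (\<lambda>_. lborel). solid_cauchy_integrand I u z \<zeta>)"
proof -
  let ?P = "PiM I (\<lambda>_. lborel :: complex measure)"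
  let ?f = "\<lambda>F \<zeta>. indicator (Pi\<^sub>E I D) \<zeta> *\<^sub>R solid_cauchy_integrand I F z \<zeta>"
  note [measurable] = sets_PiE_open[OF assms(1), where I=I]
  have u: "?f u \<in> borel_measurable ?P" by measurable
  have eq: "AE \<zeta> in ?P. ?f u \<zeta> = ?f F \<zeta>"
    using ae by eventually_elim (auto simp: solid_cauchy_integrand_def split: split_indicator)
  have F: "?f F \<in> borel_measurable (completion ?P)"
    by (rule AE_eq_imp_measurable_completion[OF u eq]) simp
  have eq': "AE \<zeta> in completion ?P. ?f F \<zeta> = ?f u \<zeta>"
    using AE_completion[OF eq] by eventually_elim (rule sym)
  have u': "?f u \<in> borel_measurable (completion ?P)"
    using u by (rule measurable_completion)
  have "integrable (completion ?P) (?f F) \<longleftrightarrow> integrable (completion ?P) (?f u)"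
    using F u' eq' by (rule integrable_cong_AE)
  then show "set_integrable (lebesgue_vars I) (Pi\<^sub>E I D) (solid_cauchy_integrand I F z) \<longleftrightarrow>
      set_integrable ?P (Pi\<^sub>E I D) (solid_cauchy_integrand I u z)"
    using u by (simp add: set_integrable_def lebesgue_vars_def integrable_completion)
  have "integral\<^sup>L (completion ?P) (?f F) = integral\<^sup>L (completion ?P) (?f u)"
    using F u' eq' by (rule integral_cong_AE)
  then show "(LINT \<zeta>:Pi\<^sub>E I D|lebesgue_vars I. solid_cauchy_integrand I F z \<zeta>) =
      (LINT \<zeta>:Pi\<^sub>E I D|?P. solid_cauchy_integrand I u z \<zeta>)"
    using u by (simp add: set_lebesgue_integral_def lebesgue_vars_def integral_completion)
qed

text \<open>Two points of a disc of radius r are less than 2 r apart, so the truncation of the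
  kernel is never felt. Equality persists for \<zeta> i = z i, where both sides are 0.\<close>

lemma norm_solid_cauchy_integrand_eq:
  assumes D: "\<And>j. D j \<subseteq> ball 0 r" and z: "z \<in> product_domain D" and \<zeta>: "\<zeta> \<in> Pi\<^sub>E I D"
  shows "ennreal (cmod (solid_cauchy_integrand I u z \<zeta>)) =
    ennreal (cmod (u (mix I \<zeta> z))) * (\<Prod>i\<in>I. cauchy_kernel (2 * r) (\<zeta> i - z $ i))"
proof -
  have "cauchy_kernel (2 * r) (\<zeta> i - z $ i) = ennreal (1 / cmod (\<zeta> i - z $ i))" if "i \<in> I" for i
  proof -
    have "w \<in> D j \<Longrightarrow> cmod w < r" for w j
      using D[of j] by auto
    then have "cmod (\<zeta> i) < r" "cmod (z $ i) < r"
      using z \<zeta> that by (auto simp: product_domain_def PiE_iff)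
    then have "cmod (\<zeta> i - z $ i) < 2 * r"
      using norm_triangle_ineq4[of "\<zeta> i" "z $ i"] by simp
    then show ?thesis by (simp add: cauchy_kernel_def)
  qed
  then have "(\<Prod>i\<in>I. cauchy_kernel (2 * r) (\<zeta> i - z $ i)) =
      ennreal (\<Prod>i\<in>I. 1 / cmod (\<zeta> i - z $ i))"
    by (simp add: prod_ennreal)
  moreover have "cmod (solid_cauchy_integrand I u z \<zeta>) =
      cmod (u (mix I \<zeta> z)) * (\<Prod>i\<in>I. 1 / cmod (\<zeta> i - z $ i))"
    by (simp add: solid_cauchy_integrand_def norm_divide prod_dividef flip: prod_norm)
  ultimately show ?thesis
    by (simp add: ennreal_mult prod_nonneg)
qed

lemma solid_cauchy_integral_le_cauchy_average:
  fixes D :: "'n::finite \<Rightarrow> complex set"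
  assumes "\<And>j. open (D j)" and D: "\<And>j. D j \<subseteq> ball 0 r"
    and [measurable]: "u \<in> borel_measurable borel" and z: "z \<in> product_domain D"
  shows "ennreal (cmod (LINT \<zeta>:Pi\<^sub>E I D|PiM I (\<lambda>_. lborel). solid_cauchy_integrand I u z \<zeta>))
      \<le> cauchy_average (2 * r) I (\<lambda>w. ennreal (cmod (u w))) z"
    and "cauchy_average (2 * r) I (\<lambda>w. ennreal (cmod (u w))) z < \<infinity> \<Longrightarrow>
      set_integrable (PiM I (\<lambda>_. lborel)) (Pi\<^sub>E I D) (solid_cauchy_integrand I u z)"
proof -
  let ?P = "PiM I (\<lambda>_. lborel :: complex measure)"
  let ?H = "cauchy_average (2 * r) I (\<lambda>w. ennreal (cmod (u w))) z"
  let ?f = "\<lambda>\<zeta>. indicator (Pi\<^sub>E I D) \<zeta> *\<^sub>R solid_cauchy_integrand I u z \<zeta>"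
  note [measurable] = sets_PiE_open[OF assms(1), where I=I]
  have f: "?f \<in> borel_measurable ?P" by measurable
  have le: "(\<integral>\<^sup>+\<zeta>. ennreal (norm (?f \<zeta>)) \<partial>?P) \<le> ?H"
    unfolding cauchy_average_def
    by (intro nn_integral_mono)
       (auto simp: indicator_def norm_solid_cauchy_integrand_eq[OF D z])
  show "set_integrable ?P (Pi\<^sub>E I D) (solid_cauchy_integrand I u z)" if "?H < \<infinity>"
    unfolding set_integrable_def using f le_less_trans[OF le that] by (intro integrableI_bounded)
  show "ennreal (cmod (LINT \<zeta>:Pi\<^sub>E I D|?P. solid_cauchy_integrand I u z \<zeta>)) \<le> ?H"
  proof (cases "integrable ?P ?f")
    case True
    then show ?thesis
      unfolding set_lebesgue_integral_def
      by (rule order_trans[OF integral_norm_bound_ennreal le])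
  \<comment> \<open>Without integrability the Bochner integral is 0 by convention, and the bound is
    trivial.\<close>
  qed (simp add: set_lebesgue_integral_def not_integrable_integral_eq)
qed

text \<open>The two prefactors combine to modulus \<open>(1 / pi) ^ card I\<close>, which is at most
  1.\<close>

lemma cmod_solid_cauchy_le:
  "cmod (solid_cauchy D I F z) \<le>
    cmod (LINT \<zeta>:Pi\<^sub>E I D|lebesgue_vars I. solid_cauchy_integrand I F z \<zeta>)"
proof -
  have "cmod (solid_cauchy D I F z) = (1 / pi) ^ card I *
      cmod (LINT \<zeta>:Pi\<^sub>E I D|lebesgue_vars I. solid_cauchy_integrand I F z \<zeta>)"
    by (simp add: solid_cauchy_def norm_mult norm_divide norm_power power_mult_distrib
        power_divide field_simps)
  also have "\<dots> \<le> 1 * cmod (LINT \<zeta>:Pi\<^sub>E I D|lebesgue_vars I. solid_cauchy_integrand I F z \<zeta>)"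
    using pi_gt3 by (intro mult_right_mono power_le_one) auto
  finally show ?thesis by simp
qed

section \<open>The \<open>L\<^sup>p\<close> estimate\<close>

lemma borel_measurable_lebesgue_on_cong_AE:
  fixes f g :: "'a::euclidean_space \<Rightarrow> complex"
  assumes [measurable]: "S \<in> sets borel" "f \<in> borel_measurable borel"
    and ae: "AE x in lborel. x \<in> S \<longrightarrow> g x = f x"
  shows "g \<in> borel_measurable (lebesgue_on S)"
proof -
  have "(\<lambda>x. indicator S x *\<^sub>R g x) \<in> borel_measurable (completion lborel)"
  proof (rule AE_eq_imp_measurable_completion)
    show "(\<lambda>x. indicator S x *\<^sub>R f x) \<in> borel_measurable lborel" by measurable
    show "AE x in lborel. indicator S x *\<^sub>R f x = indicator S x *\<^sub>R g x"
      using ae by eventually_elim (auto simp: indicator_def)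
  qed simp
  then show ?thesis by (subst borel_measurable_restrict_space_iff) auto
qed

lemma AE_lebesgue_on_iff:
  "S \<in> sets borel \<Longrightarrow> (AE x in lebesgue_on S. Q x) \<longleftrightarrow> (AE x in lborel. x \<in> S \<longrightarrow> Q x)"
  by (subst AE_restrict_space_iff) (auto simp: AE_completion_iff)

lemma nn_integral_lebesgue_on:
  "S \<in> sets borel \<Longrightarrow> (\<integral>\<^sup>+x. f x \<partial>lebesgue_on S) = (\<integral>\<^sup>+x. f x * indicator S x \<partial>lborel)"
  by (subst nn_integral_restrict_space) (auto simp: nn_integral_completion)

text \<open>Reduces estimates for finite p to integrals of p-th powers. If the integral is infinite,
  both sides are false.\<close>

lemma Lp_norm_le_ennreal_iff:
  assumes "1 \<le> p" "p \<noteq> \<infinity>" "0 \<le> c"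
  shows "Lp_norm p M u \<le> ennreal c \<longleftrightarrow>
    (\<integral>\<^sup>+x. ennreal (cmod (u x) powr enn2real p) \<partial>M) \<le> ennreal (c powr enn2real p)"
proof -
  have q: "1 \<le> enn2real p" using assms by (cases p) (auto simp: ennreal_ge_1)
  show ?thesis
  proof (cases "(\<integral>\<^sup>+x. ennreal (cmod (u x) powr enn2real p) \<partial>M)")
    case (real b)
    have "b powr (1 / enn2real p) \<le> c \<longleftrightarrow> b \<le> c powr enn2real p"
    proof
      assume "b powr (1 / enn2real p) \<le> c"
      then have "(b powr (1 / enn2real p)) powr enn2real p \<le> c powr enn2real p"
        using q by (intro powr_mono2) auto
      then show "b \<le> c powr enn2real p" using q real by (simp add: powr_powr)
    next
      assume "b \<le> c powr enn2real p"
      then have "b powr (1 / enn2real p) \<le> (c powr enn2real p) powr (1 / enn2real p)"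
        using q real by (intro powr_mono2) auto
      then show "b powr (1 / enn2real p) \<le> c" using q assms by (simp add: powr_powr)
    qed
    then show ?thesis using assms real by (simp add: Lp_norm_def)
  qed (use assms in \<open>simp add: Lp_norm_def top_unique\<close>)
qed

lemma AE_le_Lp_norm_infinity:
  assumes "Lp_norm \<infinity> M u \<le> c"
  shows "AE x in M. ennreal (cmod (u x)) \<le> c"
proof -
  have "esssup M (\<lambda>x. ennreal (cmod (u x))) \<le> c" using assms by (simp add: Lp_norm_def)
  with esssup_AE[of "\<lambda>x. ennreal (cmod (u x))" M] show ?thesis
    by (auto elim!: eventually_mono intro: order_trans)
qed

section \<open>The bound for a single partial transform\<close>

lemma one_le_enn2real:
  assumes "1 \<le> p" "p \<noteq> \<infinity>"
  shows "1 \<le> enn2real p"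
  using assms by (cases p) (auto simp: ennreal_ge_1)

text \<open>The average \<open>H\<close> of |u| dominates the transform pointwise. Its finiteness
  almost everywhere gives the existence of the integral, and its size gives the norm bound.
  \<open>K\<close> bounds the kernel mass; the 2 is the loss in the weak form of Jensen's
  inequality.\<close>

lemma Lp_solid_cauchy:
  fixes D :: "'n::finite \<Rightarrow> complex set"
  assumes D: "\<And>j. open (D j)" "\<And>j. D j \<subseteq> ball 0 r"
    and K: "(\<integral>\<^sup>+\<zeta>. cauchy_kernel (2 * r) \<zeta> \<partial>lborel) ^ card I \<le> ennreal K" "0 < K"
    and p: "1 \<le> p"
    and F: "F \<in> borel_measurable (lebesgue_on (product_domain D))"
    and c: "0 \<le> c" "Lp_norm p (lebesgue_on (product_domain D)) F \<le> ennreal c"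
  shows "AE z in lebesgue_on (product_domain D).
      set_integrable (lebesgue_vars I) (Pi\<^sub>E I D) (solid_cauchy_integrand I F z)"
    and "solid_cauchy D I F \<in> borel_measurable (lebesgue_on (product_domain D))"
    and "Lp_norm p (lebesgue_on (product_domain D)) (solid_cauchy D I F) \<le> ennreal (2 * K * c)"
proof -
  let ?P = "PiM I (\<lambda>_. lborel :: complex measure)"
  let ?\<Omega> = "product_domain D"
  note [measurable (raw)] = measurable_PiM_lborel_component
  have \<Omega> [measurable]: "?\<Omega> \<in> sets borel"
    by (intro borel_open open_product_domain D)
  obtain u where u [measurable]: "u \<in> borel_measurable borel" and u0: "\<And>w. w \<notin> ?\<Omega> \<Longrightarrow> u w = 0"
    and uF: "AE w in lborel. w \<in> ?\<Omega> \<longrightarrow> F w = u w"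
    using lebesgue_on_borel_representative[OF \<Omega> F] by metis
  define k where "k z \<zeta> = (\<Prod>i\<in>I. cauchy_kernel (2 * r) (\<zeta> i - z $ i))" for z \<zeta>
  have k [measurable]: "k z \<in> borel_measurable ?P" for z
    unfolding k_def by measurable
  have kK: "(\<integral>\<^sup>+\<zeta>. k z \<zeta> \<partial>?P) \<le> ennreal K" for z
    using K by (simp add: k_def nn_integral_prod_cauchy_kernel)
  define V where "V z = (LINT \<zeta>:Pi\<^sub>E I D|?P. solid_cauchy_integrand I u z \<zeta>)" for z
  have [measurable]: "V \<in> borel_measurable borel"
    unfolding V_def[abs_def] by (intro borel_measurable_solid_cauchy_integral D u)
  define H where "H = cauchy_average (2 * r) I (\<lambda>w. ennreal (cmod (u w)))"
  \<comment> \<open>For almost every z the slice of the set where \<open>F\<close> and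
    \<open>u\<close> differ is null, so at z the transform of \<open>F\<close> may be computed from
    \<open>u\<close>.\<close>
  have good: "AE z in lborel. z \<in> ?\<Omega> \<longrightarrow>
      solid_cauchy D I F z =
        1 / (2 * of_real pi * \<i>) ^ card I * ((2 * \<i>) ^ card I * V z) \<and>
      ennreal (cmod (solid_cauchy D I F z)) \<le> H z \<and>
      (H z < \<infinity> \<longrightarrow> set_integrable (lebesgue_vars I) (Pi\<^sub>E I D) (solid_cauchy_integrand I F z))"
    using AE_mix[OF uF, of I]
  proof eventually_elim
    case (elim z)
    show ?case
    proof
      assume z: "z \<in> ?\<Omega>"
      have ae: "AE \<zeta> in ?P. \<zeta> \<in> Pi\<^sub>E I D \<longrightarrow> F (mix I \<zeta> z) = u (mix I \<zeta> z)"
        using elim by eventually_elim (use mix_in_product_domain[OF z] in auto)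
      note eq = solid_cauchy_cong_AE[OF D(1) u ae, folded V_def]
      note H = solid_cauchy_integral_le_cauchy_average[OF D u z, of I, folded V_def H_def]
      have "ennreal (cmod (solid_cauchy D I F z)) \<le> H z"
        using cmod_solid_cauchy_le[of D I F z] H(1) unfolding eq(2)
        by (meson ennreal_leI order_trans)
      then show "solid_cauchy D I F z =
            1 / (2 * of_real pi * \<i>) ^ card I * ((2 * \<i>) ^ card I * V z) \<and>
          ennreal (cmod (solid_cauchy D I F z)) \<le> H z \<and>
          (H z < \<infinity> \<longrightarrow> set_integrable (lebesgue_vars I) (Pi\<^sub>E I D) (solid_cauchy_integrand I F z))"
        using eq H(2) by (simp add: solid_cauchy_def)
    qed
  qed
  show meas: "solid_cauchy D I F \<in> borel_measurable (lebesgue_on ?\<Omega>)"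
  proof (rule borel_measurable_lebesgue_on_cong_AE)
    show "(\<lambda>z. 1 / (2 * of_real pi * \<i>) ^ card I * ((2 * \<i>) ^ card I * V z)) \<in> borel_measurable borel"
      by measurable
    show "AE z in lborel. z \<in> ?\<Omega> \<longrightarrow> solid_cauchy D I F z =
        1 / (2 * of_real pi * \<i>) ^ card I * ((2 * \<i>) ^ card I * V z)"
      using good by eventually_elim simp
  qed simp
  \<comment> \<open>Both claims are proved together because finiteness of \<open>H\<close>, like the
    norm bound, is derived differently for finite and infinite p.\<close>
  have "(AE z in lborel. H z < \<infinity>) \<and>
    Lp_norm p (lebesgue_on ?\<Omega>) (solid_cauchy D I F) \<le> ennreal (2 * K * c)"
  proof (cases "p = \<infinity>")
    case True
    have "AE z in lebesgue_on ?\<Omega>. ennreal (cmod (F z)) \<le> ennreal c"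
      using c True by (intro AE_le_Lp_norm_infinity) auto
    then have "AE z in lborel. z \<in> ?\<Omega> \<longrightarrow> ennreal (cmod (F z)) \<le> ennreal c"
      by (simp add: AE_lebesgue_on_iff)
    \<comment> \<open>Off the domain \<open>u\<close> vanishes, so the bound holds almost everywhere
      in the whole space and \<open>AE_mix\<close> applies.\<close>
    with uF have uc: "AE z in lborel. ennreal (cmod (u z)) \<le> ennreal c"
      by eventually_elim (use u0 in force)
    have HK: "AE z in lborel. H z \<le> ennreal (c * K)"
      using AE_mix[OF uc, of I]
    proof eventually_elim
      case (elim z)
      have "H z \<le> (\<integral>\<^sup>+\<zeta>. ennreal c * k z \<zeta> \<partial>?P)"
        unfolding H_def cauchy_average_def k_def[symmetric]
        by (rule nn_integral_mono_AE, use elim in eventually_elim) (rule mult_right_mono, auto)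
      also have "\<dots> \<le> ennreal c * ennreal K"
        by (simp add: nn_integral_cmult mult_left_mono kK)
      finally show ?case using c K by (simp add: ennreal_mult)
    qed
    have "AE z in lborel. z \<in> ?\<Omega> \<longrightarrow> ennreal (cmod (solid_cauchy D I F z)) \<le> ennreal (2 * K * c)"
      using HK good
    proof eventually_elim
      case (elim z)
      \<comment> \<open>Weakened to obtain one constant for all p.\<close>
      have "ennreal (c * K) \<le> ennreal (2 * K * c)"
        using c K by (intro ennreal_leI) simp
      with elim show ?case by (meson order_trans)
    qed
    then have "esssup (lebesgue_on ?\<Omega>) (\<lambda>z. ennreal (cmod (solid_cauchy D I F z))) \<le>
        ennreal (2 * K * c)"
      using meas by (intro esssup_I) (auto simp: AE_lebesgue_on_iff)
    moreover have "AE z in lborel. H z < \<infinity>"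
      using HK by eventually_elim (auto intro: le_less_trans)
    ultimately show ?thesis using True by (simp add: Lp_norm_def)
  next
    case False
    define q where "q = enn2real p"
    have q: "1 \<le> q" unfolding q_def using p False by (rule one_le_enn2real)
    define B where "B = cauchy_average (2 * r) I (\<lambda>w. ennreal (cmod (u w) powr q))"
    have [measurable]: "B \<in> borel_measurable borel" unfolding B_def by measurable
    have B: "B z = (\<integral>\<^sup>+\<zeta>. ennreal (cmod (u (mix I \<zeta> z)) powr q) * k z \<zeta> \<partial>?P)"
      and H: "H z = (\<integral>\<^sup>+\<zeta>. ennreal (cmod (u (mix I \<zeta> z))) * k z \<zeta> \<partial>?P)" for z
      by (simp_all add: B_def H_def cauchy_average_def k_def)
    \<comment> \<open>Off the domain \<open>u\<close> is 0, and \<open>0 powr q\<close> is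
      0.\<close>
    have "(\<integral>\<^sup>+z. ennreal (cmod (u z) powr q) \<partial>lborel) =
        (\<integral>\<^sup>+z. ennreal (cmod (F z) powr q) \<partial>lebesgue_on ?\<Omega>)"
      unfolding nn_integral_lebesgue_on[OF \<Omega>]
      by (rule nn_integral_cong_AE, use uF in eventually_elim)
         (use u0 q in \<open>auto split: split_indicator\<close>)
    also have "\<dots> \<le> ennreal (c powr q)"
      using c p False by (simp add: Lp_norm_le_ennreal_iff q_def)
    finally have uq: "(\<integral>\<^sup>+z. ennreal (cmod (u z) powr q) \<partial>lborel) \<le> ennreal (c powr q)" .
    have "(\<integral>\<^sup>+z. B z \<partial>lborel) =
        (\<integral>\<^sup>+\<zeta>. cauchy_kernel (2 * r) \<zeta> \<partial>lborel) ^ card I * (\<integral>\<^sup>+z. ennreal (cmod (u z) powr q) \<partial>lborel)"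
      unfolding B_def by (rule nn_integral_cauchy_average) measurable
    also have "\<dots> \<le> ennreal K * ennreal (c powr q)"
      by (intro mult_mono K uq) auto
    finally have BK: "(\<integral>\<^sup>+z. B z \<partial>lborel) \<le> ennreal K * ennreal (c powr q)" .
    have "(\<integral>\<^sup>+z. B z \<partial>lborel) \<noteq> \<infinity>"
      using BK by (auto simp: top_unique ennreal_mult_eq_top_iff)
    then have "AE z in lborel. B z \<noteq> \<infinity>"
      by (intro nn_integral_PInf_AE) auto
    then have fin: "AE z in lborel. H z < \<infinity>"
    proof eventually_elim
      case (elim z)
      \<comment> \<open>The level t = 1 suffices for finiteness: \<open>H\<close> is at most the
        kernel mass plus \<open>B\<close>.\<close>
      have "H z \<le> ennreal 1 * (\<integral>\<^sup>+\<zeta>. k z \<zeta> \<partial>?P) + ennreal (1 powr (1 - q)) * B z"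
        unfolding H B by (rule nn_integral_weighted_le) (use q in auto)
      also have "\<dots> < \<infinity>"
        using elim le_less_trans[OF kK[of z] ennreal_less_top] by (simp add: less_top)
      finally show ?case .
    qed
    have "(\<integral>\<^sup>+z. ennreal (cmod (solid_cauchy D I F z) powr q) \<partial>lebesgue_on ?\<Omega>) \<le>
        (\<integral>\<^sup>+z. ennreal (2 powr q * K powr (q - 1)) * B z \<partial>lborel)"
      unfolding nn_integral_lebesgue_on[OF \<Omega>]
    proof (rule nn_integral_mono_AE, use good in eventually_elim)
      case (elim z)
      show ?case
      proof (cases "z \<in> ?\<Omega>")
        case True
        \<comment> \<open>Jensen's inequality at the point z, with the modulus of the transform as
          \<open>a\<close> and the kernel as weight.\<close>
        have "ennreal (cmod (solid_cauchy D I F z) powr q) \<le> ennreal (2 powr q * K powr (q - 1)) * B z"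
          unfolding B
          by (rule powr_le_nn_integral_weighted) (use q kK K elim True in \<open>auto simp: H\<close>)
        with True show ?thesis by simp
      qed simp
    qed
    also have "\<dots> \<le> ennreal (2 powr q * K powr (q - 1)) * (ennreal K * ennreal (c powr q))"
      using BK by (simp add: nn_integral_cmult mult_left_mono)
    \<comment> \<open>The mass from Tonelli's theorem raises \<open>K powr (q - 1)\<close> to
      \<open>K powr q\<close>.\<close>
    also have "\<dots> = ennreal ((2 * K * c) powr q)"
      using K c by (simp add: powr_mult powr_diff flip: ennreal_mult)
    finally have "Lp_norm p (lebesgue_on ?\<Omega>) (solid_cauchy D I F) \<le> ennreal (2 * K * c)"
      using p False K c by (subst Lp_norm_le_ennreal_iff) (auto simp: q_def)
    with fin show ?thesis by simp
  qed
  then show "Lp_norm p (lebesgue_on ?\<Omega>) (solid_cauchy D I F) \<le> ennreal (2 * K * c)"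
    and "AE z in lebesgue_on ?\<Omega>.
      set_integrable (lebesgue_vars I) (Pi\<^sub>E I D) (solid_cauchy_integrand I F z)"
    using good by (auto simp: AE_lebesgue_on_iff)
qed

text \<open>A crude substitute for Minkowski's inequality: bounding n summands by n times the
  largest gives |sum|^q \<le> n^q times the sum of the |v i|^q. Integration produces n^(q+1) c^q
  \<le> (n^2 c)^q.\<close>

lemma Lp_norm_sum_le:
  assumes A: "finite A" and p: "1 \<le> p"
    and v [measurable]: "\<And>i. i \<in> A \<Longrightarrow> v i \<in> borel_measurable M"
    and c: "0 \<le> c" "\<And>i. i \<in> A \<Longrightarrow> Lp_norm p M (v i) \<le> ennreal c"
  shows "Lp_norm p M (\<lambda>x. \<Sum>i\<in>A. v i x) \<le> ennreal ((real (card A))\<^sup>2 * c)"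
proof (cases "A = {}")
  case True
  then show ?thesis using esssup_I[of "\<lambda>_. 0 :: ennreal" M 0] by (simp add: Lp_norm_def)
next
  case False
  define n where "n = real (card A)"
  have n: "1 \<le> n" using A False by (simp add: n_def Suc_le_eq card_gt_0_iff)
  show ?thesis
  proof (cases "p = \<infinity>")
    case True
    have "AE x in M. \<forall>i\<in>A. ennreal (cmod (v i x)) \<le> ennreal c"
      using c(2) True by (intro AE_finite_allI[OF A] AE_le_Lp_norm_infinity) auto
    then have "AE x in M. ennreal (cmod (\<Sum>i\<in>A. v i x)) \<le> ennreal (n\<^sup>2 * c)"
    proof eventually_elim
      case (elim x)
      have "cmod (\<Sum>i\<in>A. v i x) \<le> (\<Sum>i\<in>A. c)"
        using elim c by (intro sum_norm_le) auto
      also have "\<dots> = n * c" by (simp add: n_def)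
      also have "\<dots> \<le> n\<^sup>2 * c"
        using n c by (intro mult_right_mono) (auto simp: power2_eq_square)
      finally show ?case by (rule ennreal_leI)
    qed
    then show ?thesis using True by (simp add: Lp_norm_def esssup_I n_def)
  next
    case False
    define q where "q = enn2real p"
    have q: "1 \<le> q" unfolding q_def using p False by (rule one_le_enn2real)
    have pt: "cmod (\<Sum>i\<in>A. v i x) powr q \<le> n powr q * (\<Sum>i\<in>A. cmod (v i x) powr q)" for x
    proof -
      define m where "m = Max ((\<lambda>i. cmod (v i x)) ` A)"
      have "m \<in> (\<lambda>i. cmod (v i x)) ` A"
        unfolding m_def using A \<open>A \<noteq> {}\<close> by (intro Max_in) auto
      then obtain j where j: "j \<in> A" "m = cmod (v j x)" by auto
      have "cmod (\<Sum>i\<in>A. v i x) \<le> (\<Sum>i\<in>A. m)"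
        using A by (intro sum_norm_le) (auto simp: m_def)
      then have "cmod (\<Sum>i\<in>A. v i x) powr q \<le> (n * m) powr q"
        using q by (intro powr_mono2) (auto simp: n_def)
      also have "\<dots> = n powr q * cmod (v j x) powr q"
        using n j by (simp add: powr_mult)
      also have "\<dots> \<le> n powr q * (\<Sum>i\<in>A. cmod (v i x) powr q)"
        using A j by (intro mult_left_mono member_le_sum) auto
      finally show ?thesis .
    qed
    have "(\<integral>\<^sup>+x. ennreal (cmod (\<Sum>i\<in>A. v i x) powr q) \<partial>M) \<le>
        (\<integral>\<^sup>+x. ennreal (n powr q) * (\<Sum>i\<in>A. ennreal (cmod (v i x) powr q)) \<partial>M)"
      using pt by (intro nn_integral_mono) (simp add: sum_nonneg ennreal_leI flip: ennreal_mult)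
    also have "\<dots> = ennreal (n powr q) * (\<Sum>i\<in>A. \<integral>\<^sup>+x. ennreal (cmod (v i x) powr q) \<partial>M)"
      by (simp add: nn_integral_cmult nn_integral_sum del: sum_ennreal)
    also have "\<dots> \<le> ennreal (n powr q) * (\<Sum>i\<in>A. ennreal (c powr q))"
      using c p False by (intro mult_left_mono sum_mono) (auto simp: Lp_norm_le_ennreal_iff q_def)
    also have "\<dots> = ennreal (n powr q * n * c powr q)"
      by (simp add: n_def ennreal_mult ennreal_of_nat_eq_real_of_nat mult_ac)
    \<comment> \<open>Uses n \<le> n^q, valid as n and q are at least 1; the result is a perfect
      q-th power.\<close>
    also have "\<dots> \<le> ennreal (n powr q * n powr q * c powr q)"
      using n q powr_mono[of 1 q n]
      by (intro ennreal_leI mult_right_mono mult_left_mono) auto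
    also have "\<dots> = ennreal ((n\<^sup>2 * c) powr q)"
      using n c by (simp add: power2_eq_square powr_mult)
    finally show ?thesis
      using p False n c by (subst Lp_norm_le_ennreal_iff) (auto simp: q_def n_def)
  qed
qed

lemma Lp_norm_uminus: "Lp_norm p M (\<lambda>x. - u x) = Lp_norm p M u"
  by (simp add: Lp_norm_def)

theorem theorem0p4:
  fixes D :: "'n::finite \<Rightarrow> complex set" and p :: ennreal
  assumes "\<And>j. piecewise_C1_domain (D j)"
    and "bounded (product_domain D)"
    and "1 \<le> p"
  shows "\<exists>C::real. C > 0 \<and>
    (\<forall>(f :: 'n \<Rightarrow> complex ^ 'n \<Rightarrow> complex) (F :: 'n set \<Rightarrow> complex ^ 'n \<Rightarrow> complex).
       weakly_dbar_closed (product_domain D) f \<and>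
       (\<forall>I. I \<noteq> {} \<longrightarrow> form_coeff (product_domain D) f I (F I) \<and>
                       in_Lp p (lebesgue_on (product_domain D)) (F I)) \<longrightarrow>
       (AE z in lebesgue_on (product_domain D). \<forall>I. I \<noteq> {} \<longrightarrow>
          set_integrable (lebesgue_vars I) (Pi\<^sub>E I D) (solid_cauchy_integrand I (F I) z)) \<and>
       in_Lp p (lebesgue_on (product_domain D)) (T_op D F) \<and>
       Lp_norm p (lebesgue_on (product_domain D)) (T_op D F)
         \<le> ennreal C * (\<Sum>I\<in>{I. I \<noteq> {}}. Lp_norm p (lebesgue_on (product_domain D)) (F I)))"
proof -
  have D: "open (D j)" "D j \<noteq> {}" for j
    using assms(1)[of j] by (auto simp: piecewise_C1_domain_def)
  obtain r where r: "0 < r" "\<And>j. D j \<subseteq> ball 0 r"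
    using bounded_component_if_bounded_product_domain[OF D(2) assms(2)] by metis
  let ?M = "lebesgue_on (product_domain D)"
  let ?A = "{I :: 'n set. I \<noteq> {}}"
  define \<kappa> where "\<kappa> = enn2real (\<integral>\<^sup>+\<zeta>. cauchy_kernel (2 * r) \<zeta> \<partial>lborel)"
  have \<kappa>: "(\<integral>\<^sup>+\<zeta>. cauchy_kernel (2 * r) \<zeta> \<partial>lborel) = ennreal \<kappa>" "0 \<le> \<kappa>"
    using nn_integral_cauchy_kernel_finite[of "2 * r"] r by (auto simp: \<kappa>_def)
  \<comment> \<open>The base 1 + \<kappa> is at least 1, so its powers increase with the exponent
    and a single \<open>K\<close> dominates the kernel masses of all \<open>I\<close>.\<close>
  define K where "K = (1 + \<kappa>) ^ CARD('n)"
  have K: "0 < K" using \<kappa> by (simp add: K_def)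
  have \<kappa>K: "ennreal \<kappa> ^ card I \<le> ennreal K" for I :: "'n set"
  proof -
    have "\<kappa> ^ card I \<le> (1 + \<kappa>) ^ card I" using \<kappa> by (intro power_mono) auto
    also have "\<dots> \<le> K" unfolding K_def
      using \<kappa> by (intro power_increasing card_mono) auto
    finally show ?thesis using \<kappa> by (simp add: ennreal_power ennreal_leI)
  qed
  \<comment> \<open>The square of the number of summands comes from \<open>Lp_norm_sum_le\<close>
    and \<open>2 * K\<close> from \<open>Lp_solid_cauchy\<close>; the added 1 makes positivity
    immediate.\<close>
  define C where "C = 1 + (real (card ?A))\<^sup>2 * (2 * K)"
  have C: "0 < C" using K by (simp add: C_def add_pos_nonneg)
  show ?thesis
  proof (intro exI[of _ C] conjI allI impI C; elim conjE)
    fix F :: "'n set \<Rightarrow> complex ^ 'n \<Rightarrow> complex" and f :: "'n \<Rightarrow> complex ^ 'n \<Rightarrow> complex"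
    assume "\<forall>I. I \<noteq> {} \<longrightarrow> form_coeff (product_domain D) f I (F I) \<and> in_Lp p ?M (F I)"
    then have meas: "F I \<in> borel_measurable ?M" and fin: "Lp_norm p ?M (F I) < \<infinity>"
      if "I \<noteq> {}" for I using that by (auto simp: in_Lp_def)
    \<comment> \<open>A finite sum of finite norms. It bounds each of them, so it serves as the
      common \<open>c\<close> for all summands.\<close>
    define S where "S = enn2real (\<Sum>I\<in>?A. Lp_norm p ?M (F I))"
    have S: "(\<Sum>I\<in>?A. Lp_norm p ?M (F I)) = ennreal S" "0 \<le> S"
      using fin by (auto simp: S_def less_top)
    have le: "Lp_norm p ?M (F I) \<le> ennreal S" if "I \<noteq> {}" for I
      unfolding S(1)[symmetric] using that by (intro member_le_sum) auto
    note sc = Lp_solid_cauchy[OF D(1) r(2) \<kappa>K[folded \<kappa>(1)] K assms(3) meas S(2) le]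
    have T: "Lp_norm p ?M (T_op D F) \<le> ennreal ((real (card ?A))\<^sup>2 * (2 * K * S))"
      unfolding T_op_def Lp_norm_uminus
      using K S by (intro Lp_norm_sum_le assms) (auto intro: sc)
    also have "\<dots> \<le> ennreal (C * S)"
      using S by (intro ennreal_leI) (simp add: C_def algebra_simps)
    also have "\<dots> = ennreal C * (\<Sum>I\<in>?A. Lp_norm p ?M (F I))"
      using S C by (simp add: ennreal_mult)
    finally show "Lp_norm p ?M (T_op D F) \<le> ennreal C * (\<Sum>I\<in>?A. Lp_norm p ?M (F I))" .
    have "T_op D F \<in> borel_measurable ?M"
      unfolding T_op_def[abs_def] by (intro borel_measurable_uminus borel_measurable_sum) (auto intro: sc)
    with T show "in_Lp p ?M (T_op D F)"
      by (auto simp: in_Lp_def intro: le_less_trans)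
    show "AE z in ?M. \<forall>I. I \<noteq> {} \<longrightarrow>
        set_integrable (lebesgue_vars I) (Pi\<^sub>E I D) (solid_cauchy_integrand I (F I) z)"
      \<comment> \<open>There are only finitely many \<open>I\<close>, so the exceptional null sets
        can be united.\<close>
      using sc(1) by (subst AE_all_countable) auto
  qed
qed

end
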